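(* Let $\mathcal{T}\ge1$, $J\ge1$, $n,\tilde n\ge1$, $\epsilon>0$, let $\Lambda=\{(t,j)\mid t\in\{0,1,\dots,\mathcal{T}\},\ j\in\{0,1,\dots,J\}\}$, let $C\in\mathbb{R}^{n\times n}$ and $\tilde C\in\mathbb{R}^{n\times\tilde n}$, and let $\mathbf{C}$ be the tensor, with one mode for each $(t,j)\in\Lambda$, with elements $$\mathbf{C}_{(i_{(t,j)}\mid(t,j)\in\Lambda)}=\sum_{t=1}^{\mathcal{T}}C_{i_{(t-1,0)},\,i_{(t,0)}}+\sum_{t=0}^{\mathcal{T}}\sum_{j=1}^J\tilde C_{i_{(t,0)},\,i_{(t,j)}}.$$ Let $\mathbf{K}=\exp(-\mathbf{C}/\epsilon)$, $K=\exp(-C/\epsilon)$, $\tilde K=\exp(-\tilde C/\epsilon)$ (elementwise exponentials), and $\mathbf{U}=\bigotimes_{(t,j)\in\Lambda}u_{(t,j)}$, where the $u_{(t,j)}$ are vectors with positive entries, $u_{(t,0)}\in\mathbb{R}^n$ and $u_{(t,j)}\in\mathbb{R}^{\tilde n}$ for $j\ge1$. Set $p_t=u_{(t,0)}\odot\bigodot_{j=1}^J\tilde Ku_{(t,j)}$ for $t=0,\dots,\mathcal{T}$. Then, for the central marginals $(t,0)$, $t=0,\dots,\mathcal{T}$, $$P_{(t,0)}(\mathbf{K}\odot\mathbf{U})=\left(p_0^TK\,\mathrm{diag}(p_1)K\cdots\mathrm{diag}(p_{t-1})K\right)^T\odot p_t\odot\left(K\,\mathrm{diag}(p_{t+1})\cdots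 K\,\mathrm{diag}(p_{\mathcal{T}-1})Kp_{\mathcal{T}}\right).$$ Furthermore, for the non-central marginals $(t,j)$ with $t=0,\dots,\mathcal{T}$ and $j=1,2,\dots,J$, $$\begin{aligned}P_{(t,j)}(\mathbf{K}\odot\mathbf{U})=u_{(t,j)}\odot\tilde K^T\Big(&\left(p_0^TK\,\mathrm{diag}(p_1)K\cdots K\,\mathrm{diag}(p_{t-1})K\right)^T\odot\big(p_t./(\tilde Ku_{(t,j)})\big)\\&\odot\left(K\,\mathrm{diag}(p_{t+1})K\cdots K\,\mathrm{diag}(p_{\mathcal{T}-1})Kp_{\mathcal{T}}\right)\Big).\end{aligned}$$
   Context: Tensors are real arrays indexed by families $(i_{(t,j)}\mid(t,j)\in\Lambda)$ with $i_{(t,0)}\in\{1,\dots,n\}$ and $i_{(t,j)}\in\{1,\dots,\tilde n\}$ for $j\ge1$. The symbols $\odot$, $\bigodot$ denote elementwise multiplication and $./$ elementwise division; $\big(\bigotimes_{(t,j)\in\Lambda}u_{(t,j)}\big)_{(i_{(t,j)})}=\prod_{(t,j)\in\Lambda}(u_{(t,j)})_{i_{(t,j)}}$; $\mathrm{diag}(u)$ is the diagonal matrix with the entries of $u$ on its diagonal. The projection $P_{(t,j)}(\mathbf{M})$ on marginal $(t,j)$ is the vector whose $k$-th entry is the sum of all elements of $\mathbf{M}$ with index $i_{(t,j)}=k$ fixed. Conventions for end cases: the left factor $p_0^TK\,\mathrm{diag}(p_1)K\cdots\mathrm{diag}(p_{t-1})K$ is $\mathbf{1}^T\mathrm{diag}(p_0)K\,\mathrm{diag}(p_1)K\cdots\mathrm{diag}(p_{t-1})K$,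 i.e. the all-ones row vector when $t=0$; the right factor $K\,\mathrm{diag}(p_{t+1})\cdots K\,\mathrm{diag}(p_{\mathcal{T}-1})Kp_{\mathcal{T}}$ is $K\,\mathrm{diag}(p_{t+1})\cdots K\,\mathrm{diag}(p_{\mathcal{T}})\mathbf{1}$, i.e. the all-ones vector when $t=\mathcal{T}$. *)

theory Defs
  imports Complex_Main "HOL-Library.FuncSet" "Jordan_Normal_Form.Matrix"
begin

text \<open>Matrices and vectors are those of \<open>Jordan_Normal_Form\<close>, whose indices start at 0:
  an index set \<open>{1, \<dots>, n}\<close> of the mathematical text is \<open>{0..<n}\<close> here.\<close>

section \<open>Elementwise operations\<close>

definition times_vec :: "real vec \<Rightarrow> real vec \<Rightarrow> real vec" (infixl \<open>\<odot>\<^sub>v\<close> 70) where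
  "x \<odot>\<^sub>v y = vec (dim_vec x) (\<lambda>k. x $ k * y $ k)"

definition divide_vec :: "real vec \<Rightarrow> real vec \<Rightarrow> real vec" (infixl \<open>\<oslash>\<^sub>v\<close> 70) where
  "x \<oslash>\<^sub>v y = vec (dim_vec x) (\<lambda>k. x $ k / y $ k)"

definition prod_vec :: "nat \<Rightarrow> ('a \<Rightarrow> real vec) \<Rightarrow> 'a set \<Rightarrow> real vec" where
  "prod_vec n f S = vec n (\<lambda>k. \<Prod>j\<in>S. f j $ k)"

definition ones_vec :: "nat \<Rightarrow> real vec" where
  "ones_vec n = vec n (\<lambda>_. 1)"

definition diag_of_vec :: "real vec \<Rightarrow> real mat" where
  "diag_of_vec x = mat_diag (dim_vec x) (\<lambda>k. x $ k)"


section \<open>Tensors\<close>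

text \<open>A multi-index assigns to every mode in a finite set \<open>\<Lambda>\<close> an index below the
  dimension of that mode. A tensor is a real function of multi-indices; only its values on
  \<open>multi_indices \<Lambda> d\<close> are meaningful.\<close>

type_synonym 'l tensor = "('l \<Rightarrow> nat) \<Rightarrow> real"

definition multi_indices :: "'l set \<Rightarrow> ('l \<Rightarrow> nat) \<Rightarrow> ('l \<Rightarrow> nat) set" where
  "multi_indices \<Lambda> d = (\<Pi>\<^sub>E l\<in>\<Lambda>. {0..<d l})"

definition times_tensor :: "'l tensor \<Rightarrow> 'l tensor \<Rightarrow> 'l tensor" (infixl \<open>\<odot>\<^sub>t\<close> 70) where
  "M \<odot>\<^sub>t N = (\<lambda>i. M i * N i)"

definition outer_prod :: "'l set \<Rightarrow> ('l \<Rightarrow> real vec) \<Rightarrow> 'l tensor" where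
  "outer_prod \<Lambda> u = (\<lambda>i. \<Prod>l\<in>\<Lambda>. u l $ i l)"

definition marginal :: "'l set \<Rightarrow> ('l \<Rightarrow> nat) \<Rightarrow> 'l \<Rightarrow> 'l tensor \<Rightarrow> real vec" where
  "marginal \<Lambda> d l M = vec (d l) (\<lambda>k. \<Sum>i\<in>{i \<in> multi_indices \<Lambda> d. i l = k}. M i)"


section \<open>The tree-structured cost\<close>

definition modes :: "nat \<Rightarrow> nat \<Rightarrow> (nat \<times> nat) set" where
  "modes T J = {0..T} \<times> {0..J}"

definition mode_dim :: "nat \<Rightarrow> nat \<Rightarrow> nat \<times> nat \<Rightarrow> nat" where
  "mode_dim n n' = (\<lambda>(t, j). if j = 0 then n else n')"

definition cost_tensor ::
    "nat \<Rightarrow> nat \<Rightarrow> real mat \<Rightarrow> real mat \<Rightarrow> (nat \<times> nat) tensor" where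
  "cost_tensor T J C C' = (\<lambda>i.
     (\<Sum>t=1..T. C $$ (i (t - 1, 0), i (t, 0))) +
     (\<Sum>t=0..T. \<Sum>j=1..J. C' $$ (i (t, 0), i (t, j))))"


section \<open>Matrix products along the central chain\<close>

definition mat_prod_list :: "nat \<Rightarrow> real mat list \<Rightarrow> real mat" where
  "mat_prod_list n As = foldr (*) As (1\<^sub>m n)"

text \<open>The row vector \<open>1\<^sup>T diag(p\<^sub>0) K diag(p\<^sub>1) K \<dots> diag(p\<^sub>t\<^sub>-\<^sub>1) K\<close>, transposed. It is the
  all-ones vector for \<open>t = 0\<close>.\<close>

definition left_factor :: "nat \<Rightarrow> real mat \<Rightarrow> (nat \<Rightarrow> real vec) \<Rightarrow> nat \<Rightarrow> real vec" where
  "left_factor n K p t =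
     row (mat_of_row (ones_vec n) *
          mat_prod_list n (map (\<lambda>s. diag_of_vec (p s) * K) [0..<t])) 0"

text \<open>The column vector \<open>K diag(p\<^sub>t\<^sub>+\<^sub>1) \<dots> K diag(p\<^sub>T) 1\<close>. It is the all-ones vector
  for \<open>t = T\<close>.\<close>

definition right_factor ::
    "nat \<Rightarrow> real mat \<Rightarrow> (nat \<Rightarrow> real vec) \<Rightarrow> nat \<Rightarrow> nat \<Rightarrow> real vec" where
  "right_factor n K p T t =
     mat_prod_list n (map (\<lambda>s. K * diag_of_vec (p s)) [t + 1..<T + 1]) *\<^sub>v ones_vec n"

end

theory Submission
  imports Defs
begin

text \<open>The entries of \<open>K \<odot> U\<close> factor along the edges of a tree: a central chain carrying
  \<open>K\<close>, with \<open>J\<close> leaves attached to each chain node by \<open>K'\<close>. Summing over the leaf indices first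
  turns each node into a weight on its central index, and the remaining sum along the chain
  is evaluated by transfer matrices, which can be cut at any node \<open>t\<close>. Fixing an index of mode
  \<open>l\<close> multiplies the vector of that mode by an indicator, so it only changes the
  weight of the node to which \<open>l\<close> belongs.\<close>

section \<open>Transfer matrices along the chain\<close>

lemma mat_prod_list_carrier:
  assumes "\<And>A. A \<in> set As \<Longrightarrow> A \<in> carrier_mat n n"
  shows "mat_prod_list n As \<in> carrier_mat n n"
  using assms
proof (induction As)
  case (Cons A As)
  then have "A \<in> carrier_mat n n" "mat_prod_list n As \<in> carrier_mat n n" by auto
  then show ?case unfolding mat_prod_list_def by auto
qed (simp add: mat_prod_list_def)

text \<open>The product is a right fold, so only prepending a matrix unfolds by definition. The left
  factor grows at its right end, which takes associativity.\<close>

lemma mat_prod_list_snoc: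
  assumes "\<And>A. A \<in> set As \<Longrightarrow> A \<in> carrier_mat n n" "B \<in> carrier_mat n n"
  shows "mat_prod_list n (As @ [B]) = mat_prod_list n As * B"
  using assms
proof (induction As)
  case Nil
  then show ?case by (simp add: mat_prod_list_def)
next
  case (Cons A As)
  have "mat_prod_list n As \<in> carrier_mat n n"
    using Cons.prems by (intro mat_prod_list_carrier) auto
  then have "A * (mat_prod_list n As * B) = A * mat_prod_list n As * B"
    using Cons.prems by (intro assoc_mult_mat[symmetric]) auto
  moreover have "mat_prod_list n (As @ [B]) = mat_prod_list n As * B"
    using Cons by auto
  ultimately show ?case by (simp add: mat_prod_list_def)
qed

section \<open>Recursions for the left and right factors\<close>

lemma diag_of_vec_carrier: "x \<in> carrier_vec n \<Longrightarrow> diag_of_vec x \<in> carrier_mat n n"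
  by (auto simp: diag_of_vec_def)

text \<open>Since \<open>x \<odot>\<^sub>v y\<close> takes its dimension from \<open>x\<close>, this
  also fixes the dimension of every elementwise product that starts with the left factor.\<close>

lemma dim_left_factor:
  assumes "K \<in> carrier_mat n n" "\<And>s. s < t \<Longrightarrow> q s \<in> carrier_vec n"
  shows "dim_vec (left_factor n K q t) = n"
proof -
  have "mat_prod_list n (map (\<lambda>s. diag_of_vec (q s) * K) [0..<t]) \<in> carrier_mat n n"
    using assms by (intro mat_prod_list_carrier) (auto intro!: mult_carrier_mat[of _ n n] diag_of_vec_carrier)
  then show ?thesis by (simp add: left_factor_def)
qed

lemma left_factor_0: "left_factor n K q 0 = ones_vec n"
proof -
  have "mat_of_row (ones_vec n) * 1\<^sub>m n = mat_of_row (ones_vec n)"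
    by (intro right_mult_one_mat) (auto simp: ones_vec_def)
  then show ?thesis
    by (simp add: left_factor_def mat_prod_list_def)
qed

text \<open>Forward recursion: the appended matrix \<open>diag_of_vec (q t) * K\<close> first
  weights entry \<open>a\<close> by node \<open>t\<close>, then sums along the edge to the next
  node.\<close>

lemma left_factor_Suc:
  assumes K: "K \<in> carrier_mat n n" and q: "\<And>s. s \<le> t \<Longrightarrow> q s \<in> carrier_vec n" and b: "b < n"
  shows "left_factor n K q (Suc t) $ b =
    (\<Sum>a<n. left_factor n K q t $ a * q t $ a * K $$ (a, b))"
proof -
  define A where "A = mat_prod_list n (map (\<lambda>s. diag_of_vec (q s) * K) [0..<t])"
  define R where "R = mat_of_row (ones_vec n) * A"
  have A: "A \<in> carrier_mat n n"
    using assms unfolding A_def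
    by (intro mat_prod_list_carrier) (auto intro!: mult_carrier_mat[of _ n n] diag_of_vec_carrier)
  have R: "R \<in> carrier_mat 1 n"
    using A by (auto simp: R_def ones_vec_def intro!: mult_carrier_mat)
  have D: "diag_of_vec (q t) \<in> carrier_mat n n" using q by (auto intro: diag_of_vec_carrier)
  have DK: "diag_of_vec (q t) * K = Matrix.mat n n (\<lambda>(i, j). q t $ i * K $$ (i, j))"
    using q[of t] mat_diag_mult_left[OF K] by (simp add: diag_of_vec_def)
  have "mat_prod_list n (map (\<lambda>s. diag_of_vec (q s) * K) [0..<Suc t])
      = A * (diag_of_vec (q t) * K)"
    using assms unfolding A_def
    by (auto intro!: mat_prod_list_snoc mult_carrier_mat[of _ n n] diag_of_vec_carrier)
  then have "left_factor n K q (Suc t) = row (R * (diag_of_vec (q t) * K)) 0"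
    using assoc_mult_mat[OF _ A mult_carrier_mat[OF D K], of "mat_of_row (ones_vec n)" 1]
    by (simp add: left_factor_def R_def ones_vec_def)
  also have "\<dots> $ b = (\<Sum>a<n. R $$ (0, a) * (q t $ a * K $$ (a, b)))"
    using R b unfolding DK by (simp add: scalar_prod_def lessThan_atLeast0)
  also have "\<dots> = (\<Sum>a<n. left_factor n K q t $ a * q t $ a * K $$ (a, b))"
    using R by (intro sum.cong) (auto simp: left_factor_def R_def A_def mult.assoc)
  finally show ?thesis .
qed

text \<open>The left factor at \<open>t\<close> sees only nodes before \<open>t\<close>. This lets
  weights altered at node \<open>t\<close> alone be exchanged for the unaltered ones; the right
  factor behaves likewise with the nodes after \<open>t\<close>.\<close>

lemma left_factor_cong:
  "(\<And>s. s < t \<Longrightarrow> p s = q s) \<Longrightarrow> left_factor n K p t = left_factor n K q t"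
  unfolding left_factor_def
  by (intro arg_cong[where f = "\<lambda>As. row (mat_of_row (ones_vec n) * mat_prod_list n As) 0"]
      map_cong) auto

lemma right_factor_refl: "right_factor n K q T T = ones_vec n"
  by (simp add: right_factor_def mat_prod_list_def ones_vec_def)

text \<open>Backward recursion: the list of matrices starts at node \<open>Suc t\<close>, and
  splitting off its first matrix leaves the right factor at \<open>Suc t\<close>.\<close>

lemma right_factor_rec:
  assumes K: "K \<in> carrier_mat n n" and q: "\<And>s. s \<le> T \<Longrightarrow> q s \<in> carrier_vec n"
    and t: "t < T" and a: "a < n"
  shows "right_factor n K q T t $ a =
    (\<Sum>b<n. K $$ (a, b) * q (Suc t) $ b * right_factor n K q T (Suc t) $ b)"
proof -
  define A where "A = mat_prod_list n (map (\<lambda>s. K * diag_of_vec (q s)) [Suc t + 1..<T + 1])"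
  have A: "A \<in> carrier_mat n n"
    using assms unfolding A_def
    by (intro mat_prod_list_carrier) (auto intro!: mult_carrier_mat[of _ n n] diag_of_vec_carrier)
  have D: "diag_of_vec (q (Suc t)) \<in> carrier_mat n n"
    using q t by (auto intro: diag_of_vec_carrier)
  have KD: "K * diag_of_vec (q (Suc t)) = Matrix.mat n n (\<lambda>(i, j). K $$ (i, j) * q (Suc t) $ j)"
    using q[of "Suc t"] t mat_diag_mult_right[OF K] by (simp add: diag_of_vec_def)
  have upt: "[t + 1..<T + 1] = Suc t # [Suc t + 1..<T + 1]"
    using t by (simp add: upt_conv_Cons)
  have "right_factor n K q T t = (K * diag_of_vec (q (Suc t))) * A *\<^sub>v ones_vec n"
    unfolding right_factor_def upt by (simp add: mat_prod_list_def A_def)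
  also have "\<dots> = (K * diag_of_vec (q (Suc t))) *\<^sub>v (A *\<^sub>v ones_vec n)"
    using A K D by (intro assoc_mult_mat_vec) (auto intro!: mult_carrier_mat simp: ones_vec_def)
  also have "A *\<^sub>v ones_vec n = right_factor n K q T (Suc t)"
    by (simp add: right_factor_def A_def)
  also have "((K * diag_of_vec (q (Suc t))) *\<^sub>v right_factor n K q T (Suc t)) $ a =
      (\<Sum>b<n. K $$ (a, b) * q (Suc t) $ b * right_factor n K q T (Suc t) $ b)"
    using a A unfolding KD
    by (auto simp: scalar_prod_def lessThan_atLeast0 right_factor_def A_def intro!: sum.cong)
  finally show ?thesis .
qed

lemma right_factor_cong:
  "(\<And>s. t < s \<Longrightarrow> s \<le> T \<Longrightarrow> p s = q s) \<Longrightarrow> right_factor n K p T t = right_factor n K q T t"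
  unfolding right_factor_def
  by (intro arg_cong[where f = "\<lambda>As. mat_prod_list n As *\<^sub>v ones_vec n"] map_cong) auto

section \<open>Sums over index paths of the chain\<close>

lemma sum_PiE_insert:
  assumes "a \<notin> A"
  shows "(\<Sum>x\<in>PiE (insert a A) B. F x) = (\<Sum>x\<in>PiE A B. \<Sum>b\<in>B a. F (x(a := b)))"
proof -
  \<comment> \<open>The map taking \<open>(b, x)\<close> to \<open>x(a := b)\<close> is injective
    because \<open>a \<notin> A\<close>, and its image is the extended function space.\<close>
  have "(\<Sum>x\<in>PiE (insert a A) B. F x) = (\<Sum>(b, x)\<in>B a \<times> PiE A B. F (x(a := b)))"
    unfolding PiE_insert_eq
    using sum.reindex[OF inj_combinator[OF assms], of F B] by (simp add: case_prod_unfold)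
  also have "\<dots> = (\<Sum>x\<in>PiE A B. \<Sum>b\<in>B a. F (x(a := b)))"
    unfolding sum.cartesian_product[symmetric] by (rule sum.swap)
  finally show ?thesis .
qed

text \<open>The test function \<open>f\<close> of the last index makes the induction go through.\<close>

lemma chain_sum_left_factor:
  fixes f :: "nat \<Rightarrow> real"
  assumes K: "K \<in> carrier_mat n n" and q: "\<And>s. s \<le> T \<Longrightarrow> q s \<in> carrier_vec n"
  shows "(\<Sum>x\<in>PiE {0..T} (\<lambda>_. {0..<n}).
      (\<Prod>t=1..T. K $$ (x (t - 1), x t)) * (\<Prod>t=0..T. q t $ x t) * f (x T)) =
    (\<Sum>a<n. left_factor n K q T $ a * q T $ a * f a)"
  using q
proof (induction T arbitrary: f)
  case 0
  \<comment> \<open>With a single node there are no edges, and writing \<open>{0..0}\<close> as an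
    insertion into the empty set reduces the sum over paths to a sum over
    \<open>x 0\<close>.\<close>
  have "(\<Sum>x\<in>PiE (insert 0 {}) (\<lambda>_. {0..<n}). q 0 $ x 0 * f (x 0)) = (\<Sum>a<n. q 0 $ a * f a)"
    by (subst sum_PiE_insert) (auto simp: lessThan_atLeast0)
  then show ?case by (simp add: left_factor_0 ones_vec_def)
next
  case (Suc T)
  have eq: "{0..Suc T} = insert (Suc T) {0..T}" by auto
  \<comment> \<open>Node \<open>Suc T\<close> lies beyond every index occurring in these products,
    so the update does not affect them.\<close>
  have update: "(\<Prod>t=1..T. K $$ ((x(Suc T := b)) (t - 1), (x(Suc T := b)) t)) =
      (\<Prod>t=1..T. K $$ (x (t - 1), x t))"
    "(\<Prod>t=0..T. q t $ (x(Suc T := b)) t) = (\<Prod>t=0..T. q t $ x t)" for x b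
    by (auto intro!: prod.cong)
  have "(\<Sum>x\<in>PiE {0..Suc T} (\<lambda>_. {0..<n}).
      (\<Prod>t=1..Suc T. K $$ (x (t - 1), x t)) * (\<Prod>t=0..Suc T. q t $ x t) * f (x (Suc T))) =
    (\<Sum>x\<in>PiE {0..T} (\<lambda>_. {0..<n}). \<Sum>b<n.
      (\<Prod>t=1..T. K $$ (x (t - 1), x t)) * (\<Prod>t=0..T. q t $ x t) *
      (K $$ (x T, b) * q (Suc T) $ b * f b))"
  proof -
    have "(\<Prod>t=1..Suc T. K $$ ((x(Suc T := b)) (t - 1), (x(Suc T := b)) t)) *
        (\<Prod>t=0..Suc T. q t $ (x(Suc T := b)) t) * f ((x(Suc T := b)) (Suc T)) =
      (\<Prod>t=1..T. K $$ (x (t - 1), x t)) * (\<Prod>t=0..T. q t $ x t) *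
        (K $$ (x T, b) * q (Suc T) $ b * f b)" for x b
      unfolding prod.cl_ivl_Suc update by (simp add: mult.assoc)
    then show ?thesis
      by (subst eq, subst sum_PiE_insert) (simp_all only: lessThan_atLeast0, simp)
  qed
  also have "\<dots> = (\<Sum>x\<in>PiE {0..T} (\<lambda>_. {0..<n}).
      (\<Prod>t=1..T. K $$ (x (t - 1), x t)) * (\<Prod>t=0..T. q t $ x t) *
      (\<Sum>b<n. K $$ (x T, b) * q (Suc T) $ b * f b))"
    by (simp add: sum_distrib_left)
  \<comment> \<open>The sum over the last node is a function of \<open>x T\<close> alone, so it
    serves as the test function in the induction hypothesis.\<close>
  also have "\<dots> = (\<Sum>a<n. left_factor n K q T $ a * q T $ a *
      (\<Sum>b<n. K $$ (a, b) * q (Suc T) $ b * f b))"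
    using Suc.prems by (intro Suc.IH) auto
  also have "\<dots> = (\<Sum>b<n. \<Sum>a<n. left_factor n K q T $ a * q T $ a *
      (K $$ (a, b) * q (Suc T) $ b * f b))"
    by (subst sum.swap) (simp add: sum_distrib_left)
  also have "\<dots> = (\<Sum>b<n. left_factor n K q (Suc T) $ b * q (Suc T) $ b * f b)"
    using Suc.prems
    by (intro sum.cong refl) (simp add: left_factor_Suc[OF K] sum_distrib_right mult.assoc)
  finally show ?case .
qed

text \<open>The cut may be made at any node. Induction runs downward from \<open>T\<close>: the
  backward recursion expands the right factor at \<open>t\<close>, and after exchanging the sums the
  forward recursion absorbs the same edge into the left factor at \<open>Suc t\<close>.\<close>

lemma chain_sum:
  assumes K: "K \<in> carrier_mat n n" and q: "\<And>s. s \<le> T \<Longrightarrow> q s \<in> carrier_vec n"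
    and "t \<le> T"
  shows "(\<Sum>x\<in>PiE {0..T} (\<lambda>_. {0..<n}).
      (\<Prod>t=1..T. K $$ (x (t - 1), x t)) * (\<Prod>t=0..T. q t $ x t)) =
    (\<Sum>a<n. left_factor n K q t $ a * q t $ a * right_factor n K q T t $ a)"
  using \<open>t \<le> T\<close>
proof (induction rule: inc_induct)
  case base
  \<comment> \<open>At \<open>t = T\<close> the right factor is the all-ones vector, which matches
    the constant test function 1.\<close>
  show ?case
    using chain_sum_left_factor[OF K q, where f = "\<lambda>_. 1"]
    by (simp add: right_factor_refl ones_vec_def)
next
  case (step t)
  have "(\<Sum>a<n. left_factor n K q t $ a * q t $ a * right_factor n K q T t $ a) =
      (\<Sum>a<n. \<Sum>b<n. left_factor n K q t $ a * q t $ a * K $$ (a, b) *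
        (q (Suc t) $ b * right_factor n K q T (Suc t) $ b))"
    using step by (intro sum.cong refl)
      (simp add: right_factor_rec[OF K q] sum_distrib_left mult.assoc)
  also have "\<dots> = (\<Sum>b<n. left_factor n K q (Suc t) $ b *
        (q (Suc t) $ b * right_factor n K q T (Suc t) $ b))"
    using step q by (subst sum.swap) (simp add: left_factor_Suc[OF K] sum_distrib_right)
  finally show ?case using step.IH by (simp add: mult.assoc)
qed

section \<open>Summing out the leaves\<close>

text \<open>A multi-index amounts to a path \<open>x\<close> of central indices together with leaf
  indices \<open>y\<close>. Separating them allows summing over \<open>y\<close> with
  \<open>x\<close> held fixed.\<close>

lemma sum_tree_indices:
  fixes F :: "(nat \<times> nat) tensor"
  shows "(\<Sum>i\<in>multi_indices (modes T J) (mode_dim n n'). F i) =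
    (\<Sum>x\<in>PiE {0..T} (\<lambda>_. {0..<n}). \<Sum>y\<in>PiE ({0..T} \<times> {1..J}) (\<lambda>_. {0..<n'}).
      F (\<lambda>(t, j). if j = 0 then x t else y (t, j)))"
  unfolding sum.cartesian_product
\<comment> \<open>Since \<open>i\<close> is \<open>undefined\<close> outside
  \<open>modes T J\<close>, its central part is already extensional on \<open>{0..T}\<close>. The
  leaf part must be restricted to discard the values at \<open>j = 0\<close>.\<close>
proof (rule sum.reindex_bij_witness[where
      i = "\<lambda>(x, y) (t, j). if j = 0 then x t else y (t, j)" and
      j = "\<lambda>i. (\<lambda>t. i (t, 0), restrict i ({0..T} \<times> {1..J}))"])
  fix i assume "i \<in> multi_indices (modes T J) (mode_dim n n')"
  then have "i \<in> PiE ({0..T} \<times> {0..J}) (\<lambda>l. {0..<mode_dim n n' l})"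
    by (simp add: multi_indices_def modes_def)
  note PiE_mem[OF this] PiE_arb[OF this]
  then have i: "t \<le> T \<Longrightarrow> j \<le> J \<Longrightarrow> i (t, j) \<in> {0..<mode_dim n n' (t, j)}"
    and undef: "\<not> (t \<le> T \<and> j \<le> J) \<Longrightarrow> i (t, j) = undefined" for t j
    by simp_all
  show "(\<lambda>t. i (t, 0), restrict i ({0..T} \<times> {1..J})) \<in>
      PiE {0..T} (\<lambda>_. {0..<n}) \<times> PiE ({0..T} \<times> {1..J}) (\<lambda>_. {0..<n'})"
  proof -
    have "i (t, 0) < n" if "t \<le> T" for t
      using i[OF that, of 0] by (simp add: mode_dim_def)
    moreover have "i (t, j) < n'" if "t \<le> T" "1 \<le> j" "j \<le> J" for t j
      using i[of t j] that by (simp add: mode_dim_def)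
    ultimately show ?thesis
      using undef by (auto simp: PiE_iff extensional_def)
  qed
  show "(case (\<lambda>t. i (t, 0), restrict i ({0..T} \<times> {1..J})) of
      (x, y) \<Rightarrow> \<lambda>(t, j). if j = 0 then x t else y (t, j)) = i"
    using undef by (auto simp: fun_eq_iff)
  then show "(case (\<lambda>t. i (t, 0), restrict i ({0..T} \<times> {1..J})) of
      (x, y) \<Rightarrow> F (\<lambda>(t, j). if j = 0 then x t else y (t, j))) = F i"
    by simp
qed (auto simp: multi_indices_def modes_def mode_dim_def PiE_iff extensional_def fun_eq_iff
    split: if_splits)

text \<open>Once the central path is fixed, the leaves are independent, so the distributive law
  turns the sum over all leaf indices into a product of single sums. Arbitrary weights
  \<open>w\<close> leave room for an indicator in any mode.\<close>

lemma sum_tree: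
  fixes \<kappa> \<kappa>' :: "nat \<Rightarrow> nat \<Rightarrow> real" and w :: "nat \<times> nat \<Rightarrow> nat \<Rightarrow> real"
  shows "(\<Sum>i\<in>multi_indices (modes T J) (mode_dim n n').
      (\<Prod>t=1..T. \<kappa> (i (t - 1, 0)) (i (t, 0))) *
      (\<Prod>t=0..T. \<Prod>j=1..J. \<kappa>' (i (t, 0)) (i (t, j))) * (\<Prod>l\<in>modes T J. w l (i l))) =
    (\<Sum>x\<in>PiE {0..T} (\<lambda>_. {0..<n}).
      (\<Prod>t=1..T. \<kappa> (x (t - 1)) (x t)) *
      (\<Prod>t=0..T. w (t, 0) (x t) * (\<Prod>j=1..J. \<Sum>b<n'. \<kappa>' (x t) b * w (t, j) b)))"
proof -
  have modes: "(\<Prod>l\<in>modes T J. g l) = (\<Prod>t=0..T. g (t, 0)) * (\<Prod>l\<in>{0..T} \<times> {1..J}. g l)"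
    for g :: "nat \<times> nat \<Rightarrow> real"
  proof -
    have "(\<Prod>l\<in>modes T J. g l) = (\<Prod>t=0..T. \<Prod>j=0..J. g (t, j))"
      by (simp add: modes_def prod.cartesian_product)
    also have "\<dots> = (\<Prod>t=0..T. g (t, 0) * (\<Prod>j=1..J. g (t, j)))"
      by (simp add: prod.atLeast_Suc_atMost)
    finally show ?thesis by (simp add: prod.distrib prod.cartesian_product)
  qed
  have "(\<Sum>y\<in>PiE ({0..T} \<times> {1..J}) (\<lambda>_. {0..<n'}).
        (\<Prod>t=0..T. \<Prod>j=1..J. \<kappa>' (x t) (y (t, j))) * (\<Prod>l\<in>{0..T} \<times> {1..J}. w l (y l))) =
      (\<Prod>t=0..T. \<Prod>j=1..J. \<Sum>b<n'. \<kappa>' (x t) b * w (t, j) b)" for x :: "nat \<Rightarrow> nat"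
  proof -
    have "(\<Prod>t=0..T. \<Prod>j=1..J. \<Sum>b<n'. \<kappa>' (x t) b * w (t, j) b) =
        (\<Prod>l\<in>{0..T} \<times> {1..J}. \<Sum>b\<in>{0..<n'}. \<kappa>' (x (fst l)) b * w l b)"
      by (simp add: prod.cartesian_product case_prod_unfold lessThan_atLeast0)
    also have "\<dots> = (\<Sum>y\<in>PiE ({0..T} \<times> {1..J}) (\<lambda>_. {0..<n'}).
        \<Prod>l\<in>{0..T} \<times> {1..J}. \<kappa>' (x (fst l)) (y l) * w l (y l))"
      by (rule prod_sum_PiE) auto
    finally show ?thesis
      by (simp add: prod.distrib prod.cartesian_product case_prod_unfold)
  qed
  note leaves = this
  \<comment> \<open>For \<open>j\<close> in \<open>{1..J}\<close> the conditional always selects the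
    leaf index.\<close>
  have split: "(\<Prod>t=0..T. \<Prod>j=1..J. \<kappa>' (x t) (if j = 0 then x t else y (t, j))) =
      (\<Prod>t=0..T. \<Prod>j=1..J. \<kappa>' (x t) (y (t, j)))"
    "(\<Prod>l\<in>{0..T} \<times> {1..J}. w l (case l of (t, j) \<Rightarrow> if j = 0 then x t else y (t, j))) =
      (\<Prod>l\<in>{0..T} \<times> {1..J}. w l (y l))" for x y
    by (auto intro!: prod.cong)
  show ?thesis
    unfolding sum_tree_indices modes
    by (simp add: split prod.distrib leaves[symmetric] sum_distrib_left ac_simps
        del: One_nat_def)
qed

section \<open>Marginals\<close>

text \<open>Fixing the index of mode \<open>l\<close> is the same as inserting an indicator. Placed
  inside the product over modes, it becomes part of the weight of mode \<open>l\<close>, and the sum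
  runs over all multi-indices.\<close>

lemma marginal_outer_prod:
  assumes "finite \<Lambda>" "l \<in> \<Lambda>" "k < d l"
  shows "marginal \<Lambda> d l (M \<odot>\<^sub>t outer_prod \<Lambda> u) $ k =
    (\<Sum>i\<in>multi_indices \<Lambda> d. M i *
      (\<Prod>m\<in>\<Lambda>. u m $ i m * (if m = l then of_bool (i m = k) else 1)))"
proof -
  have fin: "finite (multi_indices \<Lambda> d)"
    using assms by (auto simp: multi_indices_def intro: finite_PiE)
  have "(\<Prod>m\<in>\<Lambda>. if m = l then of_bool (i m = k) else (1::real)) = of_bool (i l = k)" for i
    using assms by simp
  then show ?thesis
    using assms fin
    by (auto simp: marginal_def times_tensor_def outer_prod_def prod.distrib sum.inter_filter
        intro!: sum.cong)
qed

text \<open>The exponential turns the sum of costs over the edges of the tree into a product. The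
  assumption on \<open>i\<close> keeps all indices in range, where \<open>map_mat\<close> acts
  entrywise.\<close>

lemma exp_cost_tensor:
  assumes "C \<in> carrier_mat n n" "C' \<in> carrier_mat n n'"
    and "i \<in> multi_indices (modes T J) (mode_dim n n')"
  shows "exp (- cost_tensor T J C C' i / \<epsilon>) =
    (\<Prod>t=1..T. map_mat (\<lambda>c. exp (- c / \<epsilon>)) C $$ (i (t - 1, 0), i (t, 0))) *
    (\<Prod>t=0..T. \<Prod>j=1..J. map_mat (\<lambda>c. exp (- c / \<epsilon>)) C' $$ (i (t, 0), i (t, j)))"
proof -
  have i: "i (t, j) < (if j = 0 then n else n')" if "t \<le> T" "j \<le> J" for t j
  proof -
    have "(t, j) \<in> modes T J" using that by (simp add: modes_def)
    then have "i (t, j) \<in> {0..<mode_dim n n' (t, j)}"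
      using assms(3) unfolding multi_indices_def by (rule PiE_mem[rotated])
    then show ?thesis by (simp add: mode_dim_def)
  qed
  have i0: "i (t, 0) < n" if "t \<le> T" for t using i[OF that, of 0] by simp
  have ij: "i (t, j) < n'" if "t \<le> T" "Suc 0 \<le> j" "j \<le> J" for t j
    using i[of t j] that by simp
  have "- cost_tensor T J C C' i / \<epsilon> =
      (\<Sum>t=1..T. - C $$ (i (t - 1, 0), i (t, 0)) / \<epsilon>) +
      (\<Sum>t=0..T. \<Sum>j=1..J. - C' $$ (i (t, 0), i (t, j)) / \<epsilon>)"
    by (simp add: cost_tensor_def sum_negf sum_divide_distrib add_divide_distrib
        diff_divide_distrib)
  then have "exp (- cost_tensor T J C C' i / \<epsilon>) =
      (\<Prod>t=1..T. exp (- C $$ (i (t - 1, 0), i (t, 0)) / \<epsilon>)) *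
      (\<Prod>t=0..T. \<Prod>j=1..J. exp (- C' $$ (i (t, 0), i (t, j)) / \<epsilon>))"
    by (simp only: exp_add exp_sum finite_atLeastAtMost)
  also have "\<dots> = (\<Prod>t=1..T. map_mat (\<lambda>c. exp (- c / \<epsilon>)) C $$ (i (t - 1, 0), i (t, 0))) *
      (\<Prod>t=0..T. \<Prod>j=1..J. map_mat (\<lambda>c. exp (- c / \<epsilon>)) C' $$ (i (t, 0), i (t, j)))"
    by (intro arg_cong2[where f = "(*)"] prod.cong refl)
      (use assms(1,2) in \<open>auto simp: i0 ij\<close>)
  finally show ?thesis .
qed

text \<open>This treats central and leaf marginals together: \<open>w\<close> is \<open>u\<close>
  with the indicator of index \<open>k\<close> put into mode \<open>(t, j)\<close>, and the middle
  bracket is the resulting weight of node \<open>t\<close>. The outer factors involve only other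
  nodes, hence the original \<open>p\<close>.\<close>

lemma marginal_tree:
  fixes u :: "nat \<times> nat \<Rightarrow> real vec"
  assumes C: "C \<in> carrier_mat n n" and C': "C' \<in> carrier_mat n n'"
    and K: "K = map_mat (\<lambda>c. exp (- c / \<epsilon>)) C"
    and K': "K' = map_mat (\<lambda>c. exp (- c / \<epsilon>)) C'"
    and u: "\<And>l. l \<in> modes T J \<Longrightarrow> u l \<in> carrier_vec (mode_dim n n' l)"
    and p: "\<And>t. t \<le> T \<Longrightarrow> p t = u (t, 0) \<odot>\<^sub>v prod_vec n (\<lambda>j. K' *\<^sub>v u (t, j)) {1..J}"
    and l: "t \<le> T" "j \<le> J" and k: "k < mode_dim n n' (t, j)"
    and w: "\<And>m a. w m a = u m $ a * (if m = (t, j) then of_bool (a = k) else 1)"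
  shows "marginal (modes T J) (mode_dim n n') (t, j)
      ((\<lambda>i. exp (- cost_tensor T J C C' i / \<epsilon>)) \<odot>\<^sub>t outer_prod (modes T J) u) $ k =
    (\<Sum>a<n. left_factor n K p t $ a *
      (w (t, 0) a * (\<Prod>h=1..J. \<Sum>b<n'. K' $$ (a, b) * w (t, h) b)) *
      right_factor n K p T t $ a)" (is "?lhs = _")
proof -
  \<comment> \<open>\<open>q s\<close> is the weight of node \<open>s\<close> after its leaves are
    summed out, indicator included; it agrees with \<open>p s\<close> for every node other than
    \<open>t\<close>.\<close>
  define q where
    "q s = vec n (\<lambda>a. w (s, 0) a * (\<Prod>h=1..J. \<Sum>b<n'. K' $$ (a, b) * w (s, h) b))" for s
  have K_carrier: "K \<in> carrier_mat n n" using C K by simp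
  have q_carrier: "q s \<in> carrier_vec n" for s by (simp add: q_def)
  have dims: "dim_vec (u (s, 0)) = n" "1 \<le> h \<Longrightarrow> h \<le> J \<Longrightarrow> dim_vec (u (s, h)) = n'"
    if "s \<le> T" for s h
    using u[of "(s, 0)"] u[of "(s, h)"] that by (auto simp: modes_def mode_dim_def)
  have pq: "p s = q s" if "s \<le> T" "s \<noteq> t" for s
    using that C' dims[OF that(1)] unfolding p[OF that(1)] q_def
    by (auto simp: times_vec_def prod_vec_def K' w scalar_prod_def lessThan_atLeast0
        intro!: eq_vecI prod.cong sum.cong)
  have "?lhs = (\<Sum>i\<in>multi_indices (modes T J) (mode_dim n n').
      exp (- cost_tensor T J C C' i / \<epsilon>) * (\<Prod>m\<in>modes T J. w m (i m)))"
    using l k by (subst marginal_outer_prod) (auto simp: modes_def w)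
  also have "\<dots> = (\<Sum>i\<in>multi_indices (modes T J) (mode_dim n n').
      (\<Prod>t=1..T. K $$ (i (t - 1, 0), i (t, 0))) *
      (\<Prod>t=0..T. \<Prod>j=1..J. K' $$ (i (t, 0), i (t, j))) * (\<Prod>m\<in>modes T J. w m (i m)))"
    by (intro sum.cong refl) (simp only: exp_cost_tensor[OF C C'] K K')
  also have "\<dots> = (\<Sum>x\<in>PiE {0..T} (\<lambda>_. {0..<n}).
      (\<Prod>t=1..T. K $$ (x (t - 1), x t)) *
      (\<Prod>t=0..T. w (t, 0) (x t) * (\<Prod>j=1..J. \<Sum>b<n'. K' $$ (x t, b) * w (t, j) b)))"
    by (rule sum_tree)
  also have "\<dots> = (\<Sum>x\<in>PiE {0..T} (\<lambda>_. {0..<n}).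
      (\<Prod>t=1..T. K $$ (x (t - 1), x t)) * (\<Prod>t=0..T. q t $ x t))"
    by (intro sum.cong arg_cong2[where f = "(*)"] prod.cong refl)
      (auto simp: q_def PiE_iff)
  \<comment> \<open>Cutting at \<open>t\<close> isolates the one weight that the indicator may have
    altered.\<close>
  also have "\<dots> = (\<Sum>a<n. left_factor n K q t $ a * q t $ a * right_factor n K q T t $ a)"
    using K_carrier q_carrier l(1) by (intro chain_sum)
  also have "left_factor n K q t = left_factor n K p t"
    using l(1) by (intro left_factor_cong) (simp add: pq)
  also have "right_factor n K q T t = right_factor n K p T t"
    by (intro right_factor_cong) (simp add: pq)
  finally show ?thesis by (simp add: q_def)
qed

section \<open>Central and non-central marginals of the scaled kernel\<close>

theorem proposition3:
  fixes T J n n' :: nat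
    and \<epsilon> :: real
    and C C' K K' :: "real mat"
    and u :: "nat \<times> nat \<Rightarrow> real vec"
    and p :: "nat \<Rightarrow> real vec"
    and \<Lambda> :: "(nat \<times> nat) set"
    and d :: "nat \<times> nat \<Rightarrow> nat"
    and CC KK UU :: "(nat \<times> nat) tensor"
  assumes "T \<ge> 1" and "J \<ge> 1" and "n \<ge> 1" and "n' \<ge> 1" and "\<epsilon> > 0"
    and "\<Lambda> = modes T J"
    and "d = mode_dim n n'"
    and "C \<in> carrier_mat n n"
    and "C' \<in> carrier_mat n n'"
    and "CC = cost_tensor T J C C'"
    and "KK = (\<lambda>i. exp (- CC i / \<epsilon>))"
    and "K = map_mat (\<lambda>c. exp (- c / \<epsilon>)) C"
    and "K' = map_mat (\<lambda>c. exp (- c / \<epsilon>)) C'"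
    and "\<And>l. l \<in> \<Lambda> \<Longrightarrow> u l \<in> carrier_vec (d l)"
    and "\<And>l k. l \<in> \<Lambda> \<Longrightarrow> k < d l \<Longrightarrow> u l $ k > 0"
    and "UU = outer_prod \<Lambda> u"
    and "\<And>t. t \<in> {0..T} \<Longrightarrow>
           p t = u (t, 0) \<odot>\<^sub>v prod_vec n (\<lambda>j. K' *\<^sub>v u (t, j)) {1..J}"
  shows "(\<forall>t\<in>{0..T}.
            marginal \<Lambda> d (t, 0) (KK \<odot>\<^sub>t UU) =
              left_factor n K p t \<odot>\<^sub>v p t \<odot>\<^sub>v right_factor n K p T t) \<and>
         (\<forall>t\<in>{0..T}. \<forall>j\<in>{1..J}.
            marginal \<Lambda> d (t, j) (KK \<odot>\<^sub>t UU) =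
              u (t, j) \<odot>\<^sub>v
                (transpose_mat K' *\<^sub>v
                   (left_factor n K p t \<odot>\<^sub>v (p t \<oslash>\<^sub>v (K' *\<^sub>v u (t, j))) \<odot>\<^sub>v
                    right_factor n K p T t)))"
proof (intro conjI ballI)
  note tree = marginal_tree[OF assms(8,9,12,13) assms(14)[unfolded assms(6,7)]]
  have K: "K \<in> carrier_mat n n" and K': "K' \<in> carrier_mat n n'" using assms by auto
  have u0: "dim_vec (u (t, 0)) = n" if "t \<le> T" for t
    using assms(14)[of "(t, 0)"] that by (simp add: assms(6,7) modes_def mode_dim_def)
  have uj: "dim_vec (u (t, j)) = n'" if "t \<le> T" "1 \<le> j" "j \<le> J" for t j
    using assms(14)[of "(t, j)"] that by (simp add: assms(6,7) modes_def mode_dim_def)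
  have p: "p t \<in> carrier_vec n" if "t \<le> T" for t
    using assms(17)[of t] u0[OF that] that by (simp add: times_vec_def)
  have left: "dim_vec (left_factor n K p t) = n" if "t \<le> T" for t
    using that p by (intro dim_left_factor[OF K]) simp
  have K'u: "(K' *\<^sub>v u (t, j)) $ a = (\<Sum>b<n'. K' $$ (a, b) * u (t, j) $ b)"
    if "t \<le> T" "1 \<le> j" "j \<le> J" "a < n" for t j a
    using that K' uj[of t j] by (simp add: scalar_prod_def lessThan_atLeast0)
  have p_nth: "p t $ a = u (t, 0) $ a * (\<Prod>j=1..J. \<Sum>b<n'. K' $$ (a, b) * u (t, j) $ b)"
    if "t \<le> T" "a < n" for t a
    using assms(17)[of t] that u0[of t] by (simp add: times_vec_def prod_vec_def K'u)
  fix t assume t: "t \<in> {0..T}"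
  then have tT: "t \<le> T" by simp
  let ?L = "left_factor n K p t" and ?R = "right_factor n K p T t"
  show "marginal \<Lambda> d (t, 0) (KK \<odot>\<^sub>t UU) = ?L \<odot>\<^sub>v p t \<odot>\<^sub>v ?R"
  proof (rule eq_vecI)
    fix k assume "k < dim_vec (?L \<odot>\<^sub>v p t \<odot>\<^sub>v ?R)"
    then have k: "k < n" using left[OF tT] by (simp add: times_vec_def)
    \<comment> \<open>Here the indicator multiplies \<open>u (t, 0) $ a\<close> and the leaf sums
      stay those of \<open>p t\<close>, so the sum over \<open>a\<close> collapses to
      \<open>a = k\<close>.\<close>
    have "marginal \<Lambda> d (t, 0) (KK \<odot>\<^sub>t UU) $ k = (\<Sum>a<n. ?L $ a *
        (u (t, 0) $ a * of_bool (a = k) * (\<Prod>h=1..J. \<Sum>b<n'. K' $$ (a, b) * u (t, h) $ b)) *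
        ?R $ a)"
      unfolding assms(6,7,10,11,16)
      by (subst tree[where p = p, OF _ assms(17) tT _ _ refl]) (use k in \<open>auto simp: mode_dim_def\<close>)
    also have "\<dots> = (\<Sum>a<n. if a = k then ?L $ a * p t $ a * ?R $ a else 0)"
      using p_nth[OF tT] by (intro sum.cong) auto
    also have "\<dots> = (?L \<odot>\<^sub>v p t \<odot>\<^sub>v ?R) $ k"
      using k left[OF tT] by (simp add: times_vec_def)
    finally show "marginal \<Lambda> d (t, 0) (KK \<odot>\<^sub>t UU) $ k = (?L \<odot>\<^sub>v p t \<odot>\<^sub>v ?R) $ k" .
  qed (use left[OF tT] in \<open>simp add: marginal_def times_vec_def assms(7) mode_dim_def\<close>)
  fix j assume "j \<in> {1..J}"
  then have j: "1 \<le> j" "j \<le> J" by auto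
  let ?v = "K' *\<^sub>v u (t, j)"
  \<comment> \<open>The entries of \<open>K'\<close> are exponentials, those of
    \<open>u (t, j)\<close> are positive, and \<open>n' \<ge> 1\<close> makes the sum nonempty.
    Division by \<open>?v\<close> is therefore genuine.\<close>
  have v_pos: "?v $ a > 0" if "a < n" for a
    unfolding K'u[OF tT j that]
  proof (rule sum_pos)
    fix b assume "b \<in> {..<n'}"
    then show "K' $$ (a, b) * u (t, j) $ b > 0"
      using that tT j assms(9,13) assms(15)[of "(t, j)" b]
      by (simp add: assms(6,7) modes_def mode_dim_def)
  qed (use \<open>n' \<ge> 1\<close> in \<open>auto simp: lessThan_empty_iff\<close>)
  show "marginal \<Lambda> d (t, j) (KK \<odot>\<^sub>t UU) =
    u (t, j) \<odot>\<^sub>v (transpose_mat K' *\<^sub>v (?L \<odot>\<^sub>v (p t \<oslash>\<^sub>v ?v) \<odot>\<^sub>v ?R))" (is "_ = ?rhs")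
  proof (rule eq_vecI)
    fix k assume "k < dim_vec ?rhs"
    then have k: "k < n'" using uj[OF tT j] by (simp add: times_vec_def)
    \<comment> \<open>The indicator at leaf \<open>j\<close> reduces the factor \<open>h = j\<close>
      to its single term \<open>b = k\<close>. The other factors are those of \<open>p t\<close>, so
      the change amounts to dividing by \<open>?v $ a\<close> and multiplying by that term.\<close>
    have weight: "u (t, 0) $ a * (\<Prod>h=1..J. \<Sum>b<n'. K' $$ (a, b) *
          (u (t, h) $ b * (if h = j then of_bool (b = k) else 1))) =
        p t $ a / ?v $ a * (K' $$ (a, k) * u (t, j) $ k)" if a: "a < n" for a
    proof -
      let ?S = "\<lambda>h. \<Sum>b<n'. K' $$ (a, b) * u (t, h) $ b"
      have "(\<Sum>b<n'. K' $$ (a, b) * (u (t, j) $ b * of_bool (b = k))) =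
          (\<Sum>b<n'. if b = k then K' $$ (a, b) * u (t, j) $ b else 0)"
        by (intro sum.cong) auto
      then have "(\<Prod>h=1..J. \<Sum>b<n'. K' $$ (a, b) *
            (u (t, h) $ b * (if h = j then of_bool (b = k) else 1))) =
          K' $$ (a, k) * u (t, j) $ k * (\<Prod>h\<in>{1..J} - {j}. ?S h)"
        using j k by (subst prod.remove[of _ j]) auto
      moreover have "p t $ a = u (t, 0) $ a * (?v $ a * (\<Prod>h\<in>{1..J} - {j}. ?S h))"
        using j K'u[OF tT j a] unfolding p_nth[OF tT a]
        by (subst prod.remove[of _ j]) auto
      ultimately show ?thesis using v_pos[OF a] by simp
    qed
    have "marginal \<Lambda> d (t, j) (KK \<odot>\<^sub>t UU) $ k = (\<Sum>a<n. ?L $ a *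
        (u (t, 0) $ a * (\<Prod>h=1..J. \<Sum>b<n'. K' $$ (a, b) *
          (u (t, h) $ b * (if h = j then of_bool (b = k) else 1)))) * ?R $ a)"
      unfolding assms(6,7,10,11,16)
      by (subst tree[where p = p, OF _ assms(17) tT j(2) _ refl])
        (use k j in \<open>auto simp: mode_dim_def\<close>)
    \<comment> \<open>The factor \<open>u (t, j) $ k\<close> is independent of \<open>a\<close>;
      what remains is entry \<open>k\<close> of the transposed \<open>K'\<close> applied to a vector
      indexed by \<open>a\<close>.\<close>
    also have "\<dots> = u (t, j) $ k * (\<Sum>a<n. K' $$ (a, k) * (?L $ a * (p t $ a / ?v $ a) * ?R $ a))"
      unfolding sum_distrib_left by (intro sum.cong) (simp_all add: weight del: One_nat_def)
    also have "\<dots> = ?rhs $ k"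
      using k uj[OF tT j] K' left[OF tT] p[OF tT]
      by (simp add: times_vec_def divide_vec_def scalar_prod_def lessThan_atLeast0)
    finally show "marginal \<Lambda> d (t, j) (KK \<odot>\<^sub>t UU) $ k = ?rhs $ k" .
  qed (use uj[OF tT j] j in \<open>simp add: marginal_def times_vec_def assms(7) mode_dim_def\<close>)
qed

end
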